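(* Let $A\in\mathbb{R}^{n\times n}$, $C\in\mathbb{R}^{p\times n}$, let $T\ge 1$ be an integer and $q\ge0$ an integer. The following are equivalent: (i) There is a decoder that can correct $q$ errors after $T$ steps for $(A,C)$. (ii) For all $z\in\mathbb{R}^n\setminus\{0\}$, $\;|\mathrm{supp}(Cz)\cup\mathrm{supp}(CAz)\cup\dots\cup\mathrm{supp}(CA^{T-1}z)|>2q$.
   Context: For $x\in\mathbb{R}^p$, $\mathrm{supp}(x)=\{i : x_i\neq 0\}$. A decoder is a function $D:(\mathbb{R}^p)^T\to\mathbb{R}^n$. It corrects $q$ errors after $T$ steps for $(A,C)$ if for every $x^{(0)}\in\mathbb{R}^n$ and every sequence $e^{(0)},\dots,e^{(T-1)}$ in $\mathbb{R}^p$ for which there is $K\subset\{1,\dots,p\}$ with $|K|\le q$ and $\mathrm{supp}(e^{(t)})\subset K$ for all $t$, we have $D(y^{(0)},\dots,y^{(T-1)})=x^{(0)}$, where $y^{(t)}=CA^tx^{(0)}+e^{(t)}$ for $t=0,\dots,T-1$. *)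

theory Defs
  imports "HOL-Analysis.Analysis"
begin

definition supp :: "real ^ 'p \<Rightarrow> 'p set" where
  "supp x = {i. x $ i \<noteq> 0}"

(* The type-class power ^ on real ^ 'n ^ 'n is entrywise, hence not the power for **. *)
primrec matpow :: "real ^ 'n ^ 'n \<Rightarrow> nat \<Rightarrow> real ^ 'n ^ 'n" where
  "matpow A 0 = mat 1"
| "matpow A (Suc t) = A ** matpow A t"

definition measurement ::
  "real ^ 'n ^ 'n \<Rightarrow> real ^ 'n ^ 'p \<Rightarrow> real ^ 'n \<Rightarrow> (nat \<Rightarrow> real ^ 'p) \<Rightarrow> nat \<Rightarrow> real ^ 'p" where
  "measurement A C x0 e t = (C ** matpow A t) *v x0 + e t"

(* A T-tuple over R^p is a list of length T. A decoder is therefore a function on lists, of which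
   only the values on lists of length T matter; likewise only e 0, ..., e (T - 1) matter. *)
definition corrects ::
  "real ^ 'n ^ 'n \<Rightarrow> real ^ 'n ^ 'p \<Rightarrow> nat \<Rightarrow> nat \<Rightarrow> ((real ^ 'p) list \<Rightarrow> real ^ 'n) \<Rightarrow> bool" where
  "corrects A C T q D \<longleftrightarrow>
    (\<forall>(x0 :: real ^ 'n) (e :: nat \<Rightarrow> real ^ 'p).
       (\<exists>K :: 'p set. card K \<le> q \<and> (\<forall>t<T. supp (e t) \<subseteq> K)) \<longrightarrow>
       D (map (measurement A C x0 e) [0..<T]) = x0)"

end

theory Submission
  imports Defs
begin

text \<open>By linearity, states x and y with errors d and e yield the same measurements exactly
  when the output of x - y is e - d at every time (\<open>map_measurement_eq_iff\<close>). So the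
  question is whether the output of some z \<noteq> 0 is a difference of two error sequences, each
  carried by at most q coordinates. Such a difference has joint support of size at most 2q.
  Conversely, a joint support that small splits into two sets of size at most q
  (\<open>card_le_double_split\<close>), which makes z and 0 indistinguishable. If no such z exists,
  the measurements determine the state, and a decoder need only select it.\<close>

lemma card_le_double_split:
  assumes "finite S" "card S \<le> 2 * q"
  obtains K L where "S = K \<union> L" "card K \<le> q" "card L \<le> q"
proof -
  obtain K where K: "K \<subseteq> S" "card K = min q (card S)"
    by (metis min.cobounded2 obtain_subset_with_card_n)
  have "card (S - K) = card S - card K"
    using K assms by (simp add: card_Diff_subset finite_subset)
  then have "card (S - K) \<le> q" using K assms by simp
  moreover have "S = K \<union> (S - K)" using K by blast
  ultimately show ?thesis using that[of K "S - K"] K by simp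
qed

lemma supp_diff_subset: "supp (x - y) \<subseteq> supp x \<union> supp y"
  by (auto simp: supp_def)

lemma map_measurement_eq_iff:
  "map (measurement A C x d) [0..<T] = map (measurement A C y e) [0..<T] \<longleftrightarrow>
   (\<forall>t<T. (C ** matpow A t) *v (x - y) = e t - d t)"
  by (auto simp: measurement_def matrix_vector_mult_diff_distrib algebra_simps)

theorem proposition2:
  fixes A :: "real ^ 'n ^ 'n" and C :: "real ^ 'n ^ 'p" and T q :: nat
  assumes "T \<ge> 1"
  shows "(\<exists>D :: (real ^ 'p) list \<Rightarrow> real ^ 'n. corrects A C T q D) \<longleftrightarrow>
         (\<forall>z :: real ^ 'n. z \<noteq> 0 \<longrightarrow> card (\<Union>t<T. supp ((C ** matpow A t) *v z)) > 2 * q)"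
proof
  assume "\<exists>D. corrects A C T q D"
  then obtain D where D: "\<And>x e K. \<lbrakk>card K \<le> q; \<forall>t<T. supp (e t) \<subseteq> K\<rbrakk> \<Longrightarrow>
      D (map (measurement A C x e) [0..<T]) = x"
    unfolding corrects_def by blast
  show "\<forall>z. z \<noteq> 0 \<longrightarrow> card (\<Union>t<T. supp ((C ** matpow A t) *v z)) > 2 * q"
  proof (intro allI impI, rule ccontr)
    fix z :: "real ^ 'n"
    let ?S = "\<Union>t<T. supp ((C ** matpow A t) *v z)"
    assume z: "z \<noteq> 0" and "\<not> card ?S > 2 * q"
    then obtain K L where S: "?S = K \<union> L" and K: "card K \<le> q" and L: "card L \<le> q"
      using card_le_double_split[of ?S q] by (auto simp: not_less)
    \<comment> \<open>The states z and 0 produce the same measurements when the part of the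
      output of z on K is cancelled and its part off K is imitated by errors.\<close>
    define d where "d t = (\<chi> i. if i \<in> K then - ((C ** matpow A t) *v z) $ i else 0)" for t
    define e where "e t = (\<chi> i. if i \<in> K then 0 else ((C ** matpow A t) *v z) $ i)" for t
    have "map (measurement A C z d) [0..<T] = map (measurement A C 0 e) [0..<T]"
      unfolding map_measurement_eq_iff by (simp add: vec_eq_iff d_def e_def)
    moreover have "\<forall>t<T. supp (d t) \<subseteq> K"
      by (auto simp: supp_def d_def)
    \<comment> \<open>A nonzero entry of \<open>e t\<close> sits off \<open>K\<close> but inside
      \<open>?S\<close>, hence in \<open>L\<close>.\<close>
    moreover have "\<forall>t<T. supp (e t) \<subseteq> L"
      using S by (fastforce simp: supp_def e_def split: if_splits)
    ultimately show False
      using D[OF K] D[OF L] z by metis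
  qed
next
  assume large: "\<forall>z. z \<noteq> 0 \<longrightarrow> card (\<Union>t<T. supp ((C ** matpow A t) *v z)) > 2 * q"
  \<comment> \<open>\<open>P ys x\<close> says that the state \<open>x\<close> can explain the data
    \<open>ys\<close> by an admissible error sequence.\<close>
  define P where "P ys x \<longleftrightarrow> (\<exists>e K. card K \<le> q \<and> (\<forall>t<T. supp (e t) \<subseteq> K) \<and>
      ys = map (measurement A C x e) [0..<T])" for ys x
  have unique: "x = y" if "P ys x" "P ys y" for ys x y
  proof (rule ccontr)
    assume "x \<noteq> y"
    from that obtain d K e L where K: "card K \<le> q" "\<forall>t<T. supp (d t) \<subseteq> K"
      and L: "card L \<le> q" "\<forall>t<T. supp (e t) \<subseteq> L"
      and "map (measurement A C x d) [0..<T] = map (measurement A C y e) [0..<T]"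
      unfolding P_def by metis
    then have "\<forall>t<T. (C ** matpow A t) *v (x - y) = e t - d t"
      by (simp only: map_measurement_eq_iff)
    then have "(\<Union>t<T. supp ((C ** matpow A t) *v (x - y))) \<subseteq> K \<union> L"
      using K L supp_diff_subset by fastforce
    then have "card (\<Union>t<T. supp ((C ** matpow A t) *v (x - y))) \<le> card (K \<union> L)"
      by (simp add: card_mono)
    also have "\<dots> \<le> 2 * q"
      using card_Un_le[of K L] K L by linarith
    finally show False
      using large \<open>x \<noteq> y\<close> by (simp add: not_less[symmetric])
  qed
  \<comment> \<open>On data that no state explains, \<open>THE\<close> returns an unspecified value;
    this is harmless, since \<open>corrects\<close> only evaluates the decoder on data explained by
    the true state.\<close>
  have "corrects A C T q (\<lambda>ys. THE x. P ys x)"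
    unfolding corrects_def
  proof (intro allI impI)
    fix x :: "real ^ 'n" and e :: "nat \<Rightarrow> real ^ 'p"
    assume "\<exists>K. card K \<le> q \<and> (\<forall>t<T. supp (e t) \<subseteq> K)"
    then have "P (map (measurement A C x e) [0..<T]) x"
      unfolding P_def by blast
    then show "(THE x'. P (map (measurement A C x e) [0..<T]) x') = x"
      using unique by blast
  qed
  then show "\<exists>D. corrects A C T q D" by blast
qed

end
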